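(* Let $\Delta,n\in\mathbb{N}$ with $3\leq \Delta\leq n-2$ and let $G$ be a connected graph on $n$ vertices with maximum degree $\Delta$. Let $\alpha$ be chosen uniformly at random from the set $\Omega(G)$ of proper $(\Delta+1)$-colourings of $G$. Then $$\mathbb{P}(\alpha \text{ is frozen})\leq (6/7)^{\frac{n}{\Delta+1}}.$$
   Context: All graphs are finite, simple and labeled, with vertex set $[n]=\{1,\dots,n\}$. A (proper) $k$-colouring of $G$ is a function $\alpha:V(G)\to[k]$ with $\alpha(x)\neq\alpha(y)$ for every edge $xy$. For a graph $G$ of maximum degree $\Delta$, $\Omega(G)$ denotes the set of proper $(\Delta+1)$-colourings of $G$. A colouring $\alpha\in\Omega(G)$ is frozen if for every vertex $v$ all $\Delta+1$ colours appear in the closed neighbourhood $N[v]=N(v)\cup\{v\}$. *)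

theory Defs
  imports "HOL-Probability.Probability" "Graph_Theory.Graph_Theory"
begin

text \<open>
  A simple graph is a finite, loop-free, symmetric digraph whose arcs are pairs of vertices
  (\<open>pair_graph\<close>): an undirected edge \<open>xy\<close> is represented by the two arcs \<open>(x, y)\<close> and \<open>(y, x)\<close>.
  Hence the degree of a vertex is its out-degree.
\<close>

definition max_degree :: "nat pair_pre_digraph \<Rightarrow> nat" where
  "max_degree G = Max (out_degree (with_proj G) ` pverts G)"

definition closed_neighbourhood :: "nat pair_pre_digraph \<Rightarrow> nat \<Rightarrow> nat set" where
  "closed_neighbourhood G v = {w. (v, w) \<in> parcs G} \<union> {v}"

text \<open>
  Extensional functions are used so that each colouring of the vertex set is counted exactly once,
  and not once for each choice of values outside the vertex set.
\<close>

definition proper_colourings :: "nat pair_pre_digraph \<Rightarrow> nat \<Rightarrow> (nat \<Rightarrow> nat) set" where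
  "proper_colourings G k =
     {\<alpha> \<in> pverts G \<rightarrow>\<^sub>E {1..k}. \<forall>(x, y) \<in> parcs G. \<alpha> x \<noteq> \<alpha> y}"

definition Omega :: "nat pair_pre_digraph \<Rightarrow> (nat \<Rightarrow> nat) set" where
  "Omega G = proper_colourings G (max_degree G + 1)"

definition frozen :: "nat pair_pre_digraph \<Rightarrow> (nat \<Rightarrow> nat) \<Rightarrow> bool" where
  "frozen G \<alpha> \<longleftrightarrow>
     (\<forall>v \<in> pverts G. \<forall>c \<in> {1..max_degree G + 1}. \<exists>w \<in> closed_neighbourhood G v. \<alpha> w = c)"

text \<open>
  The uniform distribution \<open>pmf_of_set\<close> is only meaningful on finite nonempty sets.
\<close>

lemma finite_Omega:
  assumes "pair_graph G"
  shows "finite (Omega G)"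
proof -
  interpret pair_graph G by fact
  have "finite (pverts G \<rightarrow>\<^sub>E {1..max_degree G + 1})"
    using pair_finite_verts by (intro finite_PiE) auto
  then show ?thesis
    unfolding Omega_def proper_colourings_def by (rule rev_finite_subset) auto
qed

lemma Omega_nonempty:
  assumes "pair_graph G"
  shows "Omega G \<noteq> {}"
proof -
  interpret pair_graph G by fact
  define k where "k = max_degree G + 1"
  have deg: "card {w. (v, w) \<in> parcs G} < k" if "v \<in> pverts G" for v
  proof -
    have "out_degree (with_proj G) v = card {w. (v, w) \<in> parcs G}"
      unfolding out_degree_def
      by (rule bij_betw_same_card[of snd])
         (force simp: bij_betw_def inj_on_def out_arcs_def image_iff)
    moreover have "out_degree (with_proj G) v \<le> max_degree G"
      unfolding max_degree_def using that pair_finite_verts by (intro Max_ge) auto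
    ultimately show ?thesis by (simp add: k_def)
  qed
  have "\<exists>\<alpha>. \<alpha> \<in> S \<rightarrow>\<^sub>E {1..k} \<and> (\<forall>x\<in>S. \<forall>y\<in>S. (x, y) \<in> parcs G \<longrightarrow> \<alpha> x \<noteq> \<alpha> y)"
    if "finite S" "S \<subseteq> pverts G" for S
    using that
  proof (induction S rule: finite_induct)
    case empty
    then show ?case by auto
  next
    case (insert v S)
    then obtain \<alpha> where \<alpha>: "\<alpha> \<in> S \<rightarrow>\<^sub>E {1..k}"
      "\<And>x y. x \<in> S \<Longrightarrow> y \<in> S \<Longrightarrow> (x, y) \<in> parcs G \<Longrightarrow> \<alpha> x \<noteq> \<alpha> y" by auto
    let ?N = "{w. (v, w) \<in> parcs G}"
    have fin: "finite ?N"
      by (rule finite_subset[of _ "pverts G"]) (auto dest: in_arcsD2 simp: pair_finite_verts)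
    have "card (\<alpha> ` ?N) < card {1..k}"
      using card_image_le[OF fin, of \<alpha>] deg[of v] insert.prems by simp
    then have "\<not> {1..k} \<subseteq> \<alpha> ` ?N"
      using card_mono[of "\<alpha> ` ?N" "{1..k}"] fin by auto
    then obtain c where c: "c \<in> {1..k}" "c \<notin> \<alpha> ` ?N" by blast
    have loop: "(x, x) \<notin> parcs G" for x
      using pair_no_loops[of "(x, x)"] by auto
    have sym: "(x, y) \<in> parcs G \<Longrightarrow> (y, x) \<in> parcs G" for x y
      using pair_sym_arcs by (auto simp: symmetric_def dest: symD)
    have "\<alpha>(v := c) \<in> insert v S \<rightarrow>\<^sub>E {1..k}"
      using \<alpha>(1) c(1) by (auto simp: PiE_def extensional_def)
    moreover have "(\<alpha>(v := c)) x \<noteq> (\<alpha>(v := c)) y"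
      if "x \<in> insert v S" "y \<in> insert v S" "(x, y) \<in> parcs G" for x y
      using that \<alpha>(2)[of x y] c(2) loop sym[of x y] by (auto split: if_splits)
    ultimately show ?case by blast
  qed
  from this[OF pair_finite_verts order_refl] obtain \<alpha> where
    "\<alpha> \<in> pverts G \<rightarrow>\<^sub>E {1..k}"
    "\<forall>x\<in>pverts G. \<forall>y\<in>pverts G. (x, y) \<in> parcs G \<longrightarrow> \<alpha> x \<noteq> \<alpha> y" by blast
  then have "\<alpha> \<in> Omega G"
    unfolding Omega_def proper_colourings_def k_def by (auto dest: in_arcsD1 in_arcsD2)
  then show ?thesis by blast
qed

end

theory Submission
  imports Defs
begin

text \<open>
  Reveal the vertices one at a time. A vertex with \<open>e\<close> neighbours already coloured has at least
  \<open>\<Delta> + 1 - e\<close> available colours in a proper colouring, and at most that many in a frozen colouring,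
  because a frozen colouring is injective on closed neighbourhoods. So the number of frozen
  colourings never gains on the number of proper ones, whatever the order.

  Given one frozen colouring, the closed neighbourhoods (stars) of the \<open>m = n / (\<Delta> + 1)\<close> vertices
  of colour 1 partition the vertex set. By connectedness every star is joined by an edge to another
  star, so at least \<open>m / 2\<close> stars can be dominated by the remaining ones. In each dominated star
  choose a vertex \<open>z\<close> with a neighbour in a dominating star. Reveal first everything else in the
  dominated stars, then the vertices \<open>z\<close>, then the dominating stars. When \<open>z\<close> is revealed, its
  colour in a frozen colouring is forced by its star, but a proper colouring has at least two
  choices. Hence the proportion of frozen colourings is at most \<open>2 powr (-m/2) \<le> (6/7) powr m\<close>.
\<close>

section \<open>Dominating sets of at most half the vertices\<close>

text \<open>Ore: the complement of a minimal dominating set is again dominating.\<close>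

lemma ex_small_dominating_set:
  assumes "finite M"
    and sym: "\<And>x y. R x y \<Longrightarrow> R y x"
    and nbr: "\<And>x. x \<in> M \<Longrightarrow> \<exists>y\<in>M. y \<noteq> x \<and> R x y"
  obtains D where "D \<subseteq> M" "2 * card D \<le> card M" "\<And>x. x \<in> M - D \<Longrightarrow> \<exists>y\<in>D. R x y"
proof -
  define dom where "dom D \<longleftrightarrow> D \<subseteq> M \<and> (\<forall>x\<in>M - D. \<exists>y\<in>D. R x y)" for D
  have "dom M" by (auto simp: dom_def)
  then obtain D where D: "dom D" and min: "\<And>E. dom E \<Longrightarrow> card D \<le> card E"
    using ex_has_least_nat[of dom M card] by blast
  have fin: "finite D" using D \<open>finite M\<close> by (auto simp: dom_def intro: finite_subset)
  have compl: "dom (M - D)"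
    unfolding dom_def
  proof (intro conjI ballI)
    fix d assume "d \<in> M - (M - D)"
    then have d: "d \<in> M" "d \<in> D" by auto
    show "\<exists>y\<in>M - D. R d y"
    proof (rule ccontr)
      assume *: "\<not> (\<exists>y\<in>M - D. R d y)"
      \<comment> \<open>If \<open>d\<close> has no neighbour outside \<open>D\<close>, then
        \<open>D - {d}\<close> still dominates: \<open>nbr\<close> gives \<open>d\<close> a
        neighbour other than itself, which must lie in \<open>D\<close>, and a vertex outside
        \<open>D\<close> is dominated by some vertex other than \<open>d\<close>. This contradicts
        minimality.\<close>
      have "\<exists>y\<in>D - {d}. R x y" if "x \<in> M - (D - {d})" for x
      proof (cases "x = d")
        case True
        then show ?thesis using nbr[OF d(1)] * by blast
      next
        case False
        then have x: "x \<in> M - D" using that by blast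
        then obtain y where y: "y \<in> D" "R x y" using D unfolding dom_def by blast
        then have "y \<noteq> d" using * sym[OF y(2)] x by blast
        then show ?thesis using y by blast
      qed
      then have "dom (D - {d})" using D unfolding dom_def by blast
      then have "card D \<le> card (D - {d})" by (rule min)
      then show False using card_Diff1_less[OF fin d(2)] by simp
    qed
  qed simp
  have "D \<subseteq> M" using D by (simp add: dom_def)
  then have sum: "card D + card (M - D) = card M"
    using fin \<open>finite M\<close> by (metis card_Diff_subset card_mono le_add_diff_inverse)
  show ?thesis
  proof (cases "2 * card D \<le> card M")
    case True
    then show ?thesis using that[of D] D by (auto simp: dom_def)
  next
    case False
    then have "2 * card (M - D) \<le> card M" using sum by simp
    then show ?thesis using that[of "M - D"] compl by (auto simp: dom_def)
  qed
qed

section \<open>Partial colourings and traces of frozen colourings\<close>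

locale degree_bounded =
  fixes V :: "'a set" and N :: "'a \<Rightarrow> 'a set" and k :: nat
  assumes finite_V: "finite V"
    and N_subset: "\<And>v. v \<in> V \<Longrightarrow> N v \<subseteq> V"
    and N_sym: "\<And>v w. w \<in> N v \<Longrightarrow> v \<in> N w"
    and N_irrefl: "\<And>v. v \<notin> N v"
    and card_N: "\<And>v. v \<in> V \<Longrightarrow> card (N v) < k"
begin

abbreviation star :: "'a \<Rightarrow> 'a set" where "star v \<equiv> insert v (N v)"

definition colourings :: "'a set \<Rightarrow> ('a \<Rightarrow> nat) set" where
  "colourings S = {\<alpha> \<in> S \<rightarrow>\<^sub>E {1..k}. \<forall>x\<in>S. \<forall>y\<in>S. y \<in> N x \<longrightarrow> \<alpha> x \<noteq> \<alpha> y}"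

definition frozens :: "('a \<Rightarrow> nat) set" where
  "frozens = {\<alpha> \<in> colourings V. \<forall>v\<in>V. {1..k} \<subseteq> \<alpha> ` star v}"

text \<open>A trace comes from a frozen colouring of the whole graph, so closed neighbourhoods
  reaching beyond \<open>S\<close> still constrain it. By contrast \<open>colourings S\<close> looks
  only at edges inside \<open>S\<close>.\<close>

definition partial_frozens :: "'a set \<Rightarrow> ('a \<Rightarrow> nat) set" where
  "partial_frozens S = (\<lambda>\<alpha>. restrict \<alpha> S) ` frozens"

lemma finite_N: "v \<in> V \<Longrightarrow> finite (N v)"
  using N_subset finite_V finite_subset by blast

lemma finite_colourings: "S \<subseteq> V \<Longrightarrow> finite (colourings S)"
  unfolding colourings_def
  by (rule finite_subset[of _ "S \<rightarrow>\<^sub>E {1..k}"])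
     (auto intro!: finite_PiE intro: finite_subset[OF _ finite_V])

lemma finite_partial_frozens: "finite (partial_frozens S)"
  unfolding partial_frozens_def frozens_def using finite_colourings[of V] by simp

text \<open>A star has at most \<open>k\<close> vertices and must show \<open>k\<close> colours, so
  no colour is repeated.\<close>

lemma frozen_bij_betw_star:
  assumes "\<alpha> \<in> frozens" "v \<in> V"
  shows "bij_betw \<alpha> (star v) {1..k}"
proof -
  have "\<alpha> ` star v \<subseteq> {1..k}"
    using assms N_subset[of v] by (auto simp: frozens_def colourings_def PiE_def Pi_def)
  moreover have "{1..k} \<subseteq> \<alpha> ` star v" using assms by (auto simp: frozens_def)
  ultimately have im: "\<alpha> ` star v = {1..k}" by blast
  have "card (star v) \<le> k" using card_N[OF assms(2)] finite_N[OF assms(2)] N_irrefl by simp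
  moreover have "k \<le> card (star v)"
    using card_image_le[of "star v" \<alpha>] im finite_N[OF assms(2)] by simp
  ultimately have "card (\<alpha> ` star v) = card (star v)" unfolding im by simp
  then have "inj_on \<alpha> (star v)"
    using finite_N[OF assms(2)] by (intro eq_card_imp_inj_on) auto
  then show ?thesis using im by (simp add: bij_betw_def)
qed

section \<open>Extension by one vertex\<close>

text \<open>Each coloured neighbour of \<open>v\<close> blocks at most one colour; coinciding
  colours only leave more choices.\<close>

lemma card_colourings_insert:
  assumes "v \<in> V" "S \<subseteq> V" "v \<notin> S"
  shows "(k - card (N v \<inter> S)) * card (colourings S) \<le> card (colourings (insert v S))"
proof -
  define P where "P = Sigma (colourings S) (\<lambda>f. {1..k} - f ` (N v \<inter> S))"
  have fin: "finite P" unfolding P_def using finite_colourings[OF assms(2)] by auto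
  have "(k - card (N v \<inter> S)) * card (colourings S)
      = (\<Sum>f\<in>colourings S. k - card (N v \<inter> S))" by simp
  also have "\<dots> \<le> (\<Sum>f\<in>colourings S. card ({1..k} - f ` (N v \<inter> S)))"
  proof (rule sum_mono)
    fix f assume "f \<in> colourings S"
    have f: "finite (N v \<inter> S)" using finite_N[OF assms(1)] by blast
    have "k - card (N v \<inter> S) \<le> card {1..k} - card (f ` (N v \<inter> S))"
      using card_image_le[OF f, of f] by simp
    also have "\<dots> \<le> card ({1..k} - f ` (N v \<inter> S))"
      using f by (intro diff_card_le_card_Diff) auto
    finally show "k - card (N v \<inter> S) \<le> card ({1..k} - f ` (N v \<inter> S))" .
  qed
  also have "\<dots> = card P"
    unfolding P_def using finite_colourings[OF assms(2)] by (subst card_SigmaI) auto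
  also have "\<dots> \<le> card (colourings (insert v S))"
  proof (rule card_inj_on_le)
    show "inj_on (\<lambda>(f, c). f(v := c)) P"
    proof (rule inj_onI, clarify)
      fix f c f' c' assume a: "(f, c) \<in> P" "(f', c') \<in> P" "f(v := c) = f'(v := c')"
      \<comment> \<open>Both functions are extensional on \<open>S\<close> and
        \<open>v \<notin> S\<close>, so both are \<open>undefined\<close> at \<open>v\<close> and
        overwriting there loses no information.\<close>
      have "f v = f' v" using a assms(3)
        by (auto simp: P_def colourings_def PiE_def extensional_def)
      then show "f = f' \<and> c = c'" using a(3) by (metis fun_upd_eqD fun_upd_triv fun_upd_upd)
    qed
    show "(\<lambda>(f, c). f(v := c)) ` P \<subseteq> colourings (insert v S)"
    proof clarify
      fix f c assume "(f, c) \<in> P"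
      then have f: "f \<in> S \<rightarrow>\<^sub>E {1..k}" "\<And>x y. x \<in> S \<Longrightarrow> y \<in> S \<Longrightarrow> y \<in> N x \<Longrightarrow> f x \<noteq> f y"
        and c: "c \<in> {1..k}" "\<And>x. x \<in> N v \<Longrightarrow> x \<in> S \<Longrightarrow> c \<noteq> f x"
        by (auto simp: P_def colourings_def)
      have "f(v := c) \<in> insert v S \<rightarrow>\<^sub>E {1..k}"
        using f(1) c(1) by (auto simp: PiE_def extensional_def)
      moreover have "(f(v := c)) x \<noteq> (f(v := c)) y"
        if "x \<in> insert v S" "y \<in> insert v S" "y \<in> N x" for x y
        using that f(2)[of x y] c(2)[of x] c(2)[of y] N_irrefl[of v] N_sym[of y x]
        by (auto split: if_splits)
      ultimately show "f(v := c) \<in> colourings (insert v S)"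
        unfolding colourings_def by blast
    qed
    show "finite (colourings (insert v S))" using assms by (intro finite_colourings) auto
  qed
  finally show ?thesis .
qed

text \<open>A frozen colouring is injective on \<open>star v\<close>, so the coloured neighbours
  block exactly \<open>card (N v \<inter> S)\<close> colours. Some remaining colours may not
  continue to a frozen colouring, hence only an upper bound.\<close>

lemma card_partial_frozens_insert:
  assumes "v \<in> V" "S \<subseteq> V" "v \<notin> S"
  shows "card (partial_frozens (insert v S)) \<le> (k - card (N v \<inter> S)) * card (partial_frozens S)"
proof -
  define P where "P = Sigma (partial_frozens S) (\<lambda>f. {1..k} - f ` (N v \<inter> S))"
  have fin: "finite P" unfolding P_def using finite_partial_frozens by auto
  have "partial_frozens (insert v S) \<subseteq> (\<lambda>(f, c). f(v := c)) ` P"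
  proof
    fix g assume "g \<in> partial_frozens (insert v S)"
    then obtain \<alpha> where \<alpha>: "\<alpha> \<in> frozens" "g = restrict \<alpha> (insert v S)"
      by (auto simp: partial_frozens_def)
    have "\<alpha> v \<in> {1..k}" using \<alpha>(1) assms(1) by (auto simp: frozens_def colourings_def PiE_def Pi_def)
    moreover have "\<alpha> v \<notin> restrict \<alpha> S ` (N v \<inter> S)"
      using \<alpha>(1) assms(1,2) by (auto simp: frozens_def colourings_def)
    ultimately have "(restrict \<alpha> S, \<alpha> v) \<in> P" using \<alpha>(1) by (auto simp: P_def partial_frozens_def)
    moreover have "g = (restrict \<alpha> S)(v := \<alpha> v)" using \<alpha>(2) by (auto simp: restrict_def)
    ultimately show "g \<in> (\<lambda>(f, c). f(v := c)) ` P" by force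
  qed
  then have "card (partial_frozens (insert v S)) \<le> card P"
    using surj_card_le fin by blast
  also have "\<dots> = (\<Sum>f\<in>partial_frozens S. card ({1..k} - f ` (N v \<inter> S)))"
    unfolding P_def using finite_partial_frozens by (subst card_SigmaI) auto
  also have "\<dots> = (\<Sum>f\<in>partial_frozens S. k - card (N v \<inter> S))"
  proof (rule sum.cong[OF refl])
    fix f assume "f \<in> partial_frozens S"
    then obtain \<alpha> where \<alpha>: "\<alpha> \<in> frozens" "f = restrict \<alpha> S"
      by (auto simp: partial_frozens_def)
    have im: "f ` (N v \<inter> S) = \<alpha> ` (N v \<inter> S)" using \<alpha>(2) by auto
    have bij: "bij_betw \<alpha> (star v) {1..k}" by (rule frozen_bij_betw_star[OF \<alpha>(1) assms(1)])
    have "card (\<alpha> ` (N v \<inter> S)) = card (N v \<inter> S)"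
      using bij by (intro card_image) (auto simp: bij_betw_def inj_on_def)
    moreover have "\<alpha> ` (N v \<inter> S) \<subseteq> {1..k}" using bij by (auto simp: bij_betw_def)
    ultimately show "card ({1..k} - f ` (N v \<inter> S)) = k - card (N v \<inter> S)"
      using im finite_N[OF assms(1)] by (subst card_Diff_subset) auto
  qed
  finally show ?thesis by (simp add: mult.commute)
qed

text \<open>Once the rest of a star is coloured, its last vertex \<open>z\<close> must take the one
  colour missing there, so restriction to \<open>S\<close> is injective on traces.\<close>

lemma card_partial_frozens_insert_forced:
  assumes "u \<in> V" "z \<in> star u" "star u - {z} \<subseteq> S"
  shows "card (partial_frozens (insert z S)) \<le> card (partial_frozens S)"
proof (rule card_inj_on_le)
  have forced: "{\<alpha> z} = {1..k} - \<alpha> ` (star u - {z})" if "\<alpha> \<in> frozens" for \<alpha>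
  proof -
    have "bij_betw \<alpha> (star u) {1..k}" by (rule frozen_bij_betw_star[OF that assms(1)])
    then show ?thesis
      using assms(2) unfolding bij_betw_def inj_on_def by blast
  qed
  show "inj_on (\<lambda>f. restrict f S) (partial_frozens (insert z S))"
  proof (rule inj_onI)
    fix f g assume "f \<in> partial_frozens (insert z S)" "g \<in> partial_frozens (insert z S)"
      and eq: "restrict f S = restrict g S"
    then obtain \<alpha> \<beta> where \<alpha>: "\<alpha> \<in> frozens" "f = restrict \<alpha> (insert z S)"
      and \<beta>: "\<beta> \<in> frozens" "g = restrict \<beta> (insert z S)"
      by (auto simp: partial_frozens_def)
    have S: "\<alpha> x = \<beta> x" if "x \<in> S" for x
      using fun_cong[OF eq, of x] that \<alpha>(2) \<beta>(2) by simp
    have "\<alpha> ` (star u - {z}) = \<beta> ` (star u - {z})"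
      using S assms(3) by (intro image_cong) auto
    then have "\<alpha> z = \<beta> z" using forced[OF \<alpha>(1)] forced[OF \<beta>(1)] by (metis singleton_inject)
    then show "f = g" using S \<alpha>(2) \<beta>(2) by (auto simp: restrict_def)
  qed
  show "(\<lambda>f. restrict f S) ` partial_frozens (insert z S) \<subseteq> partial_frozens S"
    by (auto simp: partial_frozens_def image_iff Int_absorb1 subset_insertI)
qed (rule finite_partial_frozens)

section \<open>The ratio of proper to frozen colourings along a reveal order\<close>

lemma ratio_insert:
  assumes "v \<in> V" "S \<subseteq> V" "v \<notin> S"
    and "c * card (partial_frozens S) \<le> card (colourings S)"
  shows "c * card (partial_frozens (insert v S)) \<le> card (colourings (insert v S))"
proof -
  let ?e = "k - card (N v \<inter> S)"
  have "c * card (partial_frozens (insert v S)) \<le> ?e * (c * card (partial_frozens S))"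
    using mult_le_mono2[OF card_partial_frozens_insert[OF assms(1-3)], of c]
    by (simp add: ac_simps)
  also have "\<dots> \<le> ?e * card (colourings S)" using assms(4) by simp
  also have "\<dots> \<le> card (colourings (insert v S))" by (rule card_colourings_insert[OF assms(1-3)])
  finally show ?thesis .
qed

text \<open>The uncoloured neighbour \<open>a\<close> leaves at most \<open>k - 2\<close> coloured
  ones, hence two colours for a proper extension, while the star of \<open>u\<close> leaves a frozen
  trace no choice: the ratio doubles.\<close>

lemma ratio_insert_forced:
  assumes "z \<in> V" "S \<subseteq> V" "z \<notin> S"
    and u: "u \<in> V" "z \<in> star u" "star u - {z} \<subseteq> S"
    and a: "a \<in> N z" "a \<notin> S"
    and "c * card (partial_frozens S) \<le> card (colourings S)"
  shows "2 * c * card (partial_frozens (insert z S)) \<le> card (colourings (insert z S))"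
proof -
  have "card (N z \<inter> S) < card (N z)"
    using a finite_N[OF assms(1)] by (intro psubset_card_mono) auto
  then have "2 \<le> k - card (N z \<inter> S)" using card_N[OF assms(1)] by simp
  then have "2 * card (colourings S) \<le> card (colourings (insert z S))"
    using card_colourings_insert[OF assms(1-3)] mult_le_mono1 order_trans by blast
  moreover have "c * card (partial_frozens (insert z S)) \<le> card (colourings S)"
    using card_partial_frozens_insert_forced[OF u] assms(9) mult_le_mono2 order_trans by blast
  ultimately show ?thesis by (simp add: mult.assoc)
qed

lemma ratio_Un:
  assumes "finite T" "T \<subseteq> V" "S \<subseteq> V" "S \<inter> T = {}"
    and "c * card (partial_frozens S) \<le> card (colourings S)"
  shows "c * card (partial_frozens (S \<union> T)) \<le> card (colourings (S \<union> T))"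
  using assms
proof (induction T rule: finite_induct)
  case (insert v T)
  then show ?case using ratio_insert[of v "S \<union> T" c] by auto
qed simp

text \<open>The star of \<open>z\<close> is completed by \<open>S\<close> alone and the uncoloured
  neighbour avoids all of \<open>Z\<close>, so the doubling applies to each vertex of
  \<open>Z\<close> whichever others were revealed before it.\<close>

lemma ratio_Un_forced:
  assumes "finite Z" "Z \<subseteq> V" "S \<subseteq> V" "S \<inter> Z = {}"
    and "\<And>z. z \<in> Z \<Longrightarrow> \<exists>u\<in>V. z \<in> star u \<and> star u - {z} \<subseteq> S"
    and "\<And>z. z \<in> Z \<Longrightarrow> \<exists>a\<in>N z. a \<notin> S \<and> a \<notin> Z"
    and "card (partial_frozens S) \<le> card (colourings S)"
  shows "2 ^ card Z * card (partial_frozens (S \<union> Z)) \<le> card (colourings (S \<union> Z))"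
  using assms
proof (induction Z rule: finite_induct)
  case (insert z Z)
  have IH: "2 ^ card Z * card (partial_frozens (S \<union> Z)) \<le> card (colourings (S \<union> Z))"
  proof (rule insert.IH)
    show "Z \<subseteq> V" "S \<subseteq> V" "S \<inter> Z = {}"
      "card (partial_frozens S) \<le> card (colourings S)"
      using insert.prems(1-3,6) by auto
    show "\<exists>u\<in>V. w \<in> star u \<and> star u - {w} \<subseteq> S" if "w \<in> Z" for w
      using that by (intro insert.prems(4)) simp
    show "\<exists>a\<in>N w. a \<notin> S \<and> a \<notin> Z" if "w \<in> Z" for w
      using insert.prems(5)[of w] that by auto
  qed
  obtain u where u: "u \<in> V" "z \<in> star u" "star u - {z} \<subseteq> S" using insert.prems(4)[of z] by blast
  obtain a where a: "a \<in> N z" "a \<notin> S" "a \<notin> insert z Z" using insert.prems(5)[of z] by blast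
  have "2 * 2 ^ card Z * card (partial_frozens (insert z (S \<union> Z)))
      \<le> card (colourings (insert z (S \<union> Z)))"
    using IH u a insert.prems(1-3) insert.hyps(2)
    by (intro ratio_insert_forced[of z _ u a]) auto
  then show ?case using insert.hyps by simp
qed simp

lemma partial_frozens_V: "partial_frozens V = frozens"
proof -
  have "restrict \<alpha> V = \<alpha>" if "\<alpha> \<in> frozens" for \<alpha>
    using that by (intro extensional_restrict) (auto simp: frozens_def colourings_def PiE_def)
  then show ?thesis by (simp add: partial_frozens_def)
qed

section \<open>The partition into stars and the choice of order\<close>

text \<open>Connectedness enters through \<open>closed\<close>: an edge leaves every star. In the
  result, \<open>m\<close> counts the stars of the partition and \<open>j\<close> the dominated
  ones.\<close>

lemma card_frozens_le:
  assumes "1 \<le> k" and closed: "\<And>v. v \<in> V \<Longrightarrow> \<exists>x\<in>star v. \<not> N x \<subseteq> star v"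
    and ne: "frozens \<noteq> {}"
  obtains m j where "card V = k * m" "m \<le> 2 * j" "2 ^ j * card frozens \<le> card (colourings V)"
proof -
  obtain \<alpha> where \<alpha>: "\<alpha> \<in> frozens" using ne by blast
  define M where "M = {v \<in> V. \<alpha> v = 1}"
  have "1 \<in> {1..k}" using assms(1) by simp
  have finM: "finite M" "M \<subseteq> V" using finite_V by (auto simp: M_def)
  \<comment> \<open>Every closed neighbourhood shows colour 1 exactly once: at least once gives
    \<open>centre\<close>, at most once gives \<open>uniq\<close>. Together they make the stars
    centred in \<open>M\<close> a partition.\<close>
  have centre: "\<exists>v\<in>M. w \<in> star v" if "w \<in> V" for w
  proof -
    have "1 \<in> \<alpha> ` star w"
      using frozen_bij_betw_star[OF \<alpha> that] \<open>1 \<in> {1..k}\<close> by (auto simp: bij_betw_def)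
    then show ?thesis using N_subset[OF that] that N_sym by (force simp: M_def)
  qed
  have uniq: "v = v'" if "v \<in> M" "v' \<in> M" "w \<in> star v" "w \<in> star v'" for v v' w
  proof -
    have "w \<in> V" using that N_subset by (auto simp: M_def)
    then have "inj_on \<alpha> (star w)" using frozen_bij_betw_star[OF \<alpha>] by (auto simp: bij_betw_def)
    moreover have "v \<in> star w" "v' \<in> star w" using that N_sym by auto
    ultimately show ?thesis using that(1,2) by (auto simp: M_def inj_on_def)
  qed
  have star_subset: "star v \<subseteq> V" if "v \<in> M" for v
    using that N_subset by (auto simp: M_def)
  have "(\<Union>v\<in>M. star v) = V" using centre N_subset by (auto simp: M_def)
  moreover have "card (\<Union>v\<in>M. star v) = (\<Sum>v\<in>M. card (star v))"
  proof (rule card_UN_disjoint[OF finM(1)])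
    show "\<forall>v\<in>M. finite (star v)" using finM(2) finite_N by blast
    show "\<forall>v\<in>M. \<forall>v'\<in>M. v \<noteq> v' \<longrightarrow> star v \<inter> star v' = {}" using uniq by blast
  qed
  ultimately have "card V = (\<Sum>v\<in>M. card (star v))" by simp
  also have "\<dots> = (\<Sum>v\<in>M. k)"
  proof (rule sum.cong[OF refl])
    fix v assume "v \<in> M"
    then show "card (star v) = k"
      using bij_betw_same_card[OF frozen_bij_betw_star[OF \<alpha>, of v]] by (auto simp: M_def)
  qed
  finally have card_V: "card V = k * card M" by simp

  \<comment> \<open>Stars are related when an edge joins them. An edge leaving one star ends in
    another by \<open>centre\<close>, so the relation on \<open>M\<close> has no isolated
    vertex.\<close>
  define R where "R v v' \<longleftrightarrow> (\<exists>x\<in>star v. \<exists>y\<in>star v'. y \<in> N x)" for v v'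
  have R_sym: "R y x" if "R x y" for x y using that N_sym unfolding R_def by blast
  have R_nbr: "\<exists>y\<in>M. y \<noteq> x \<and> R x y" if "x \<in> M" for x
  proof -
    have x: "x \<in> V" using that by (simp add: M_def)
    obtain p q where p: "p \<in> star x" and q: "q \<in> N p" "q \<notin> star x" using closed[OF x] by blast
    have "q \<in> V" using p q N_subset x by blast
    then obtain y where y: "y \<in> M" "q \<in> star y" using centre by blast
    have "R x y" unfolding R_def using p q(1) y(2) by (intro bexI)
    moreover have "y \<noteq> x" using q(2) y(2) by metis
    ultimately show ?thesis using y(1) by blast
  qed
  obtain D where D: "D \<subseteq> M" "2 * card D \<le> card M" "\<And>x. x \<in> M - D \<Longrightarrow> \<exists>y\<in>D. R x y"
    using ex_small_dominating_set[of M R] finM(1) R_sym R_nbr by blast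
  define A where "A = (\<Union>d\<in>D. star d)"
  have "\<forall>v\<in>M - D. \<exists>x\<in>star v. \<exists>a\<in>A. a \<in> N x" using D(3) unfolding A_def R_def by blast
  then obtain z where z: "\<And>v. v \<in> M - D \<Longrightarrow> z v \<in> star v"
    and zA: "\<And>v. v \<in> M - D \<Longrightarrow> \<exists>a\<in>A. a \<in> N (z v)" by metis
  define Z where "Z = z ` (M - D)"
  have AV: "A \<subseteq> V" unfolding A_def using D(1) star_subset by (intro UN_least) auto
  have ZV: "Z \<subseteq> V" unfolding Z_def
  proof (rule image_subsetI)
    fix v assume "v \<in> M - D"
    then show "z v \<in> V" using z[of v] star_subset[of v] by (meson DiffD1 subsetD)
  qed
  have AZ: "A \<inter> Z = {}"
  proof -
    have "z v \<notin> star d" if "v \<in> M - D" "d \<in> D" for v d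
    proof
      assume "z v \<in> star d"
      moreover have "v \<in> M" "d \<in> M" using that D(1) by auto
      ultimately have "v = d" using uniq[OF _ _ z[OF that(1)]] by metis
      then show False using that by simp
    qed
    then show ?thesis unfolding A_def Z_def by (intro equals0I) (elim IntE UN_E imageE, metis)
  qed
  have "inj_on z (M - D)"
  proof (rule inj_onI)
    fix v v' assume v: "v \<in> M - D" "v' \<in> M - D" "z v = z v'"
    show "v = v'" using uniq[OF _ _ z[OF v(1)], of v'] z[OF v(2)] v by (metis DiffD1)
  qed
  then have card_Z: "card Z = card M - card D"
    unfolding Z_def using card_Diff_subset[OF finite_subset[OF D(1) finM(1)] D(1)]
    by (simp add: card_image)
  \<comment> \<open>The reveal order is \<open>S\<close> (the dominated stars without their chosen
    vertices), then \<open>Z\<close>, then the dominating stars \<open>A\<close>.\<close>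
  define S where "S = V - A - Z"
  have S: "S \<subseteq> V" "S \<inter> Z = {}" "(S \<union> Z) \<inter> A = {}" "S \<union> Z \<union> A = V"
    using AV ZV AZ by (auto simp: S_def)
  have fin: "finite Z" "finite A" "finite S" using AV ZV S(1) finite_V by (auto intro: finite_subset)
  \<comment> \<open>Start of the process: only one function has empty domain, so the ratio begins
    with \<open>c = 1\<close>.\<close>
  have "colourings {} = {\<lambda>_. undefined}" by (auto simp: colourings_def)
  moreover have "partial_frozens {} \<subseteq> {\<lambda>_. undefined}"
    by (auto simp: partial_frozens_def restrict_def)
  then have "card (partial_frozens {}) \<le> 1"
    using card_mono[of "{\<lambda>_. undefined}" "partial_frozens {}"] by simp
  ultimately have "card (partial_frozens S) \<le> card (colourings S)"
    using ratio_Un[of S "{}" 1] fin(3) S(1) by simp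
  moreover have "\<exists>u\<in>V. w \<in> star u \<and> star u - {w} \<subseteq> S" if "w \<in> Z" for w
  proof -
    obtain v where v: "v \<in> M - D" "w = z v" using \<open>w \<in> Z\<close> unfolding Z_def by blast
    \<comment> \<open>Distinct stars of the partition are disjoint and \<open>Z\<close> takes one
      vertex from each dominated star, so the rest of the star of \<open>v\<close> lies in
      \<open>S\<close>.\<close>
    have "x \<in> S" if "x \<in> star v" "x \<noteq> w" for x
    proof -
      have "x \<in> V" using that(1) v(1) star_subset[of v] by (meson DiffD1 subsetD)
      moreover have "x \<notin> A"
      proof
        assume "x \<in> A"
        then obtain d where d: "d \<in> D" "x \<in> star d" unfolding A_def by blast
        have "v = d" using uniq[OF _ _ that(1) d(2)] v(1) d(1) D(1) by (meson DiffD1 subsetD)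
        then show False using d(1) v(1) by simp
      qed
      moreover have "x \<notin> Z"
      proof
        assume "x \<in> Z"
        then obtain v' where v': "v' \<in> M - D" "x = z v'" unfolding Z_def by blast
        have "v = v'" using uniq[OF _ _ that(1), of v'] v(1) v' z[OF v'(1)] by (meson DiffD1)
        then show False using \<open>x \<noteq> w\<close> v(2) v'(2) by simp
      qed
      ultimately show ?thesis by (simp add: S_def)
    qed
    then show ?thesis using v z[OF v(1)] finM(2)
      by (intro bexI[of _ v]) auto
  qed
  moreover have "\<exists>a\<in>N w. a \<notin> S \<and> a \<notin> Z" if "w \<in> Z" for w
  proof -
    obtain a where "a \<in> A" "a \<in> N w" using \<open>w \<in> Z\<close> zA unfolding Z_def by blast
    then show ?thesis using AZ by (auto simp: S_def)
  qed
  ultimately have "2 ^ card Z * card (partial_frozens (S \<union> Z)) \<le> card (colourings (S \<union> Z))"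
    using fin(1) ZV S(1,2) by (intro ratio_Un_forced) auto
  then have "2 ^ card Z * card (partial_frozens (S \<union> Z \<union> A)) \<le> card (colourings (S \<union> Z \<union> A))"
    using fin(2) AV S(1,3) ZV by (intro ratio_Un[of A "S \<union> Z"]) auto
  then have "2 ^ card Z * card frozens \<le> card (colourings V)"
    by (simp only: S(4) partial_frozens_V)
  moreover have "card M \<le> 2 * card Z" using card_Z D(2) by simp
  ultimately show ?thesis by (intro that[OF card_V])
qed

end

section \<open>Connected graphs and the final estimate\<close>

lemma (in pair_graph) connected_closed_set:
  assumes "Digraph_Component.connected (with_proj G)"
    and "v \<in> pverts G" "v \<in> S"
    and closed: "\<And>x y. x \<in> S \<Longrightarrow> (x, y) \<in> parcs G \<Longrightarrow> y \<in> S"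
  shows "pverts G \<subseteq> S"
proof
  fix w assume "w \<in> pverts G"
  have "v \<rightarrow>\<^sup>*\<^bsub>with_proj G\<^esub> w"
    using assms(1,2) \<open>w \<in> pverts G\<close> reachable_mk_symmetric_eq[OF pair_sym_arcs]
    by (auto simp: connected_def strongly_connected_def)
  then show "w \<in> S"
  proof (induction rule: reachable_induct)
    case base
    show ?case by (rule assms(3))
  next
    case (step x y)
    then show ?case using closed[of x y] by simp
  qed
qed

theorem theorem1:
  fixes \<Delta> n :: nat and G :: "nat pair_pre_digraph"
  assumes "3 \<le> \<Delta>" and "\<Delta> + 2 \<le> n"
    and "pair_graph G" and "pverts G = {1..n}"
    and "Digraph_Component.connected (with_proj G)"
    and "max_degree G = \<Delta>"
  shows "measure_pmf.prob (pmf_of_set (Omega G)) {\<alpha>. frozen G \<alpha>}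
           \<le> (6 / 7) powr (real n / (real \<Delta> + 1))"
proof -
  interpret pair_graph G by fact
  define k where "k = \<Delta> + 1"
  define N where "N v = {w. (v, w) \<in> parcs G}" for v
  have card_N: "card (N v) < k" if "v \<in> pverts G" for v
  proof -
    have "out_degree (with_proj G) v = card (N v)"
      unfolding out_degree_def N_def
      by (rule bij_betw_same_card[of snd])
         (force simp: bij_betw_def inj_on_def out_arcs_def image_iff)
    moreover have "out_degree (with_proj G) v \<le> max_degree G"
      unfolding max_degree_def using that pair_finite_verts by (intro Max_ge) auto
    ultimately show ?thesis using assms(6) by (simp add: k_def)
  qed
  interpret degree_bounded "pverts G" N k
  proof
    show "w \<in> N v \<Longrightarrow> v \<in> N w" for v w
      using pair_sym_arcs by (auto simp: N_def symmetric_def dest: symD)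
    show "v \<notin> N v" for v using pair_no_loops[of "(v, v)"] by (auto simp: N_def)
  qed (auto simp: N_def pair_finite_verts card_N[unfolded N_def] dest: in_arcsD2)
  have \<Omega>: "colourings (pverts G) = Omega G"
    using in_arcsD1 in_arcsD2
    unfolding colourings_def unfolding Omega_def proper_colourings_def assms(6) k_def N_def
    by fastforce
  have cn: "closed_neighbourhood G v = star v" for v
    by (auto simp: closed_neighbourhood_def N_def)
  have F: "frozens = Omega G \<inter> {\<alpha>. frozen G \<alpha>}"
    unfolding frozens_def \<Omega> unfolding frozen_def cn assms(6) k_def by (auto 4 4 simp: image_iff)
  have prob: "measure_pmf.prob (pmf_of_set (Omega G)) {\<alpha>. frozen G \<alpha>}
      = real (card frozens) / real (card (Omega G))"
    using finite_Omega[OF assms(3)] Omega_nonempty[OF assms(3)]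
    by (simp add: measure_pmf_of_set F)
  show ?thesis
  \<comment> \<open>Without frozen colourings the probability is 0; otherwise the star partition
    makes \<open>n / (\<Delta> + 1)\<close> the integer \<open>m\<close>.\<close>
  proof (cases "frozens = {}")
    case True
    then show ?thesis by (simp add: prob)
  next
    case False
    \<comment> \<open>A star that no edge leaves would be the whole vertex set by connectedness, but
      it has at most \<open>\<Delta> + 1 < n\<close> vertices.\<close>
    have "\<exists>x\<in>star v. \<not> N x \<subseteq> star v" if "v \<in> pverts G" for v
    proof (rule ccontr)
      assume "\<not> ?thesis"
      then have "pverts G \<subseteq> star v"
        using connected_closed_set[OF assms(5) that, of "star v"] by (auto simp: N_def)
      then have "card (pverts G) \<le> card (star v)"
        using finite_N[OF that] by (intro card_mono) auto
      then show False
        using card_N[OF that] card_insert_le_m1[of k "N v" v] assms(2,4) by (simp add: k_def)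
    qed
    then obtain m j where m: "card (pverts G) = k * m" "m \<le> 2 * j"
      and j: "2 ^ j * card frozens \<le> card (colourings (pverts G))"
      using card_frozens_le False by (auto simp: k_def)
    have pos: "0 < card (Omega G)"
      using finite_Omega[OF assms(3)] Omega_nonempty[OF assms(3)] by (simp add: card_gt_0_iff)
    have "real (2 ^ j * card frozens) \<le> real (card (Omega G))"
      using j unfolding \<Omega> by (rule of_nat_mono)
    then have "real (card frozens) / real (card (Omega G)) \<le> (1 / 2) ^ j"
      using pos by (simp add: field_simps power_divide)
    \<comment> \<open>Here \<open>1 / 2 \<le> 36 / 49\<close>. The square matches
      \<open>m \<le> 2 * j\<close>: each doubling has to pay for up to two stars.\<close>
    also have "\<dots> \<le> ((6 / 7)\<^sup>2) ^ j" by (intro power_mono) (auto simp: power2_eq_square)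
    also have "\<dots> = (6 / 7 :: real) ^ (2 * j)" by (simp add: power_mult)
    also have "\<dots> \<le> (6 / 7) ^ m" using m(2) by (intro power_decreasing) auto
    also have "\<dots> = (6 / 7) powr (real n / (real \<Delta> + 1))"
    proof -
      have "n = k * m" using m(1) assms(4) by simp
      then have "real n / (real \<Delta> + 1) = real m" by (simp add: k_def field_simps)
      then show ?thesis by (simp add: powr_realpow)
    qed
    finally show ?thesis by (simp add: prob)
  qed
qed

end
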